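(* Let $\mathcal{H}$ be a complex Hilbert space and let $A,B,C\in\mathcal{B}(\mathcal{H})$. Then $$dw\begin{pmatrix} A & B\\ 0 & C\end{pmatrix}\leq\max\left\{dw(A),dw(C)\right\}+\|A^*B\|+\begin{cases}\dfrac{\|B\|}{2\sqrt{1-\|B\|^2}}, & \|B\|<\frac{1}{\sqrt{2}},\\[2mm] \|B\|^2, & \|B\|\geq\frac{1}{\sqrt{2}}.\end{cases}$$
   Context: $\mathcal{B}(\mathcal{H})$ is the algebra of bounded linear operators on the complex Hilbert space $\mathcal{H}$, with operator norm $\|\cdot\|$. A $2\times2$ operator matrix acts on the Hilbert space direct sum $\mathcal{H}\oplus\mathcal{H}$ (norm $\|(x,y)\|^2=\|x\|^2+\|y\|^2$) in the usual way. For a bounded operator $T$ on a complex Hilbert space, the Davis-Wielandt radius is $dw(T)=\sup\{\sqrt{|\langle Tz,z\rangle|^2+\|Tz\|^4}: \|z\|=1\}$. *)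

theory Defs
  imports "HOL-Analysis.Analysis"
begin

class complex_vector = real_vector +
  fixes scaleC :: "complex \<Rightarrow> 'a \<Rightarrow> 'a" (infixr "*\<^sub>C" 75)
  assumes scaleC_add_right: "c *\<^sub>C (x + y) = c *\<^sub>C x + c *\<^sub>C y"
    and scaleC_add_left: "(c + d) *\<^sub>C x = c *\<^sub>C x + d *\<^sub>C x"
    and scaleC_scaleC: "c *\<^sub>C (d *\<^sub>C x) = (c * d) *\<^sub>C x"
    and scaleR_scaleC: "r *\<^sub>R x = complex_of_real r *\<^sub>C x"

(* The inner product is linear in the first argument. Positive definiteness, and
   norm x = sqrt (Re (cinner x x)), come from real_inner through inner_cinner. *)
class complex_inner = complex_vector + real_inner +
  fixes cinner :: "'a \<Rightarrow> 'a \<Rightarrow> complex"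
  assumes cinner_commute: "cinner x y = cnj (cinner y x)"
    and cinner_add_left: "cinner (x + y) z = cinner x z + cinner y z"
    and cinner_scaleC_left: "cinner (c *\<^sub>C x) y = c * cinner x y"
    and inner_cinner: "inner x y = Re (cinner x y)"

class chilbert_space = complex_inner + complete_space

instantiation complex :: chilbert_space
begin

definition scaleC_complex_def: "c *\<^sub>C (x::complex) = c * x"
definition cinner_complex_def: "cinner (x::complex) y = x * cnj y"

instance
  by standard
    (simp_all add: scaleC_complex_def cinner_complex_def algebra_simps
      scaleR_conv_of_real inner_complex_def)

end

(* The Hilbert space direct sum; the library norm on pairs is
   norm (x, y) = sqrt ((norm x)^2 + (norm y)^2). *)
instantiation prod :: (complex_vector, complex_vector) complex_vector
begin

definition scaleC_prod_def: "c *\<^sub>C p = (c *\<^sub>C fst p, c *\<^sub>C snd p)"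

instance
  by standard
    (simp_all add: scaleC_prod_def scaleR_prod_def prod_eq_iff
      scaleC_add_right scaleC_add_left scaleC_scaleC scaleR_scaleC)

end

instantiation prod :: (complex_inner, complex_inner) complex_inner
begin

definition cinner_prod_def: "cinner p q = cinner (fst p) (fst q) + cinner (snd p) (snd q)"

instance
proof
  fix p q r :: "'a \<times> 'b" and c :: complex
  show "cinner p q = cnj (cinner q p)"
    unfolding cinner_prod_def
    by (metis cinner_commute complex_cnj_add)
  show "cinner (p + q) r = cinner p r + cinner q r"
    by (simp add: cinner_prod_def cinner_add_left)
  show "cinner (c *\<^sub>C p) q = c * cinner p q"
    by (simp add: cinner_prod_def scaleC_prod_def cinner_scaleC_left distrib_left)
  show "inner p q = Re (cinner p q)"
    by (simp add: cinner_prod_def inner_prod_def inner_cinner)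
qed

end

instance prod :: (chilbert_space, chilbert_space) chilbert_space ..

(* Elements of B(H) are functions satisfying this predicate; their operator norm is onorm. *)
locale bounded_clinear = bounded_linear f
  for f :: "'a::complex_inner \<Rightarrow> 'b::complex_inner" +
  assumes scaleC: "f (c *\<^sub>C x) = c *\<^sub>C f x"

definition cadjoint :: "('a::chilbert_space \<Rightarrow> 'b::chilbert_space) \<Rightarrow> 'b \<Rightarrow> 'a" where
  "cadjoint f = (THE g. \<forall>x y. cinner (f x) y = cinner x (g y))"

(* On the zero space the supremum is over the empty set, hence an unspecified constant, the same
   for all operators. *)
definition dw :: "('a::chilbert_space \<Rightarrow> 'a) \<Rightarrow> real" where
  "dw T = (SUP z\<in>{z. norm z = 1}. sqrt ((cmod (cinner (T z) z))\<^sup>2 + norm (T z) ^ 4))"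

definition op_matrix ::
  "('a::chilbert_space \<Rightarrow> 'a) \<Rightarrow> ('a \<Rightarrow> 'a) \<Rightarrow> ('a \<Rightarrow> 'a) \<Rightarrow> ('a \<Rightarrow> 'a) \<Rightarrow> 'a \<times> 'a \<Rightarrow> 'a \<times> 'a"
  where "op_matrix A B C D = (\<lambda>(x, y). (A x + B y, C x + D y))"

end

theory Submission
  imports Defs
begin

text \<open>
  Put \<open>v(T, z) = (\<langle>T z, z\<rangle>, \<parallel>T z\<parallel>\<^sup>2)\<close>, a point of \<open>\<complex> \<times> \<real>\<close>, so that \<open>dw T\<close> is the supremum of the
  Euclidean norm of \<open>v(T, z)\<close> over unit vectors \<open>z\<close>. For \<open>z = (x, y)\<close> and the block matrix \<open>T\<close>,
  the point \<open>v(T, z)\<close> splits as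
  \<open>v(A, x) + v(C, y) + (0, 2 Re \<langle>x, A\<^sup>* B y\<rangle>) + (\<langle>B y, x\<rangle>, \<parallel>B y\<parallel>\<^sup>2)\<close>. By homogeneity the first two
  summands contribute a convex combination of \<open>dw A\<close> and \<open>dw C\<close>, and the third at most
  \<open>\<parallel>A\<^sup>* B\<parallel>\<close> because \<open>2 \<parallel>x\<parallel> \<parallel>y\<parallel> \<le> 1\<close>. With \<open>u = \<parallel>y\<parallel>\<^sup>2\<close> and \<open>b = \<parallel>B\<parallel>\<close>, the square of the norm of the
  last one is at most \<open>b\<^sup>2 (u - (1 - b\<^sup>2) u\<^sup>2)\<close>, whose maximum over \<open>[0, 1]\<close> gives the two cases.
\<close>

section \<open>Riesz representation and adjoints\<close>

text \<open>The real form suffices: it is applied to \<open>inner (f x) y\<close>, and the complex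
  adjoint identity is recovered from real parts afterwards.\<close>

theorem riesz_representation:
  fixes f :: "'a::{real_inner,complete_space} \<Rightarrow> real"
  assumes "bounded_linear f"
  shows "\<exists>u. \<forall>x. f x = inner x u"
proof -
  interpret bounded_linear f by fact
  \<comment> \<open>The representing vector is the minimiser of this functional; the parallelogram law makes
    every minimising sequence Cauchy.\<close>
  define J where "J x = (norm x)\<^sup>2 - 2 * f x" for x
  have J_lower: "- (onorm f)\<^sup>2 \<le> J x" for x
  proof -
    have "f x \<le> onorm f * norm x"
      using onorm[OF assms, of x] by simp
    moreover have "0 \<le> (norm x - onorm f)\<^sup>2" by simp
    ultimately show ?thesis
      unfolding J_def power2_diff by (simp add: algebra_simps)
  qed
  then have bdd: "bdd_below (range J)" by (auto intro!: bdd_belowI)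
  define m where "m = Inf (range J)"
  have m_le: "m \<le> J x" for x
    unfolding m_def using bdd by (auto intro: cInf_lower)
  define r where "r n = inverse (real (Suc n))" for n
  have r_pos: "0 < r n" for n by (simp add: r_def)
  have "\<exists>x. J x < m + r n" for n
  proof -
    have "Inf (range J) < m + r n" using r_pos by (simp add: m_def)
    then show ?thesis using cInf_lessD[of "range J"] by blast
  qed
  then obtain X where X: "\<And>n. J (X n) < m + r n" by metis
  \<comment> \<open>By linearity of \<open>f\<close> the linear terms of \<open>J\<close> cancel at
    the midpoint, leaving the parallelogram identity.\<close>
  have parallelogram: "(norm (x - y))\<^sup>2 = 2 * (J x + J y - 2 * J ((1/2) *\<^sub>R (x + y)))" for x y
    unfolding J_def
    by (simp add: power2_norm_eq_inner add scaleR inner_simps inner_commute algebra_simps)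
  have dist_X: "(norm (X i - X j))\<^sup>2 \<le> 2 * (r i + r j)" for i j
  proof -
    have "J (X i) + J (X j) - 2 * J ((1/2) *\<^sub>R (X i + X j))
        \<le> (m + r i) + (m + r j) - 2 * m"
      by (intro diff_mono add_mono mult_left_mono m_le less_imp_le[OF X]) simp
    then show ?thesis unfolding parallelogram by simp
  qed
  have "Cauchy X"
  proof (rule metric_CauchyI)
    fix e :: real assume "0 < e"
    then obtain N where N: "r N < e\<^sup>2 / 4"
      using reals_Archimedean[of "e\<^sup>2 / 4"] unfolding r_def by auto
    have "dist (X i) (X j) < e" if "N \<le> i" "N \<le> j" for i j
    proof -
      have "r i \<le> r N" "r j \<le> r N"
        using that unfolding r_def by (auto intro!: le_imp_inverse_le)
      then have "2 * (r i + r j) \<le> 2 * (r N + r N)" by (intro mult_left_mono add_mono) auto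
      also have "\<dots> < e\<^sup>2" using N by simp
      finally have "(norm (X i - X j))\<^sup>2 < e\<^sup>2" using dist_X[of i j] by (rule le_less_trans[rotated])
      then show ?thesis
        using \<open>0 < e\<close> by (simp add: dist_norm power2_less_imp_less)
    qed
    then show "\<exists>N. \<forall>i\<ge>N. \<forall>j\<ge>N. dist (X i) (X j) < e" by blast
  qed
  then obtain u where u: "X \<longlonglongrightarrow> u" using Cauchy_convergent convergent_def by blast
  have "(\<lambda>n. J (X n)) \<longlonglongrightarrow> J u"
    unfolding J_def by (intro tendsto_intros u tendsto)
  moreover have "(\<lambda>n. m + r n) \<longlonglongrightarrow> m"
    using tendsto_add[OF tendsto_const LIMSEQ_inverse_real_of_nat, of m] by (simp add: r_def)
  ultimately have "J u \<le> m"
    by (rule LIMSEQ_le) (use X in \<open>auto intro!: less_imp_le\<close>)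
  then have J_min: "J u \<le> J x" for x using m_le[of x] by simp
  have "f h = inner h u" for h
  proof (rule ccontr)
    define d where "d = inner h u - f h"
    \<comment> \<open>\<open>- d / q\<close> stands in for the minimiser
      \<open>- d / (norm h)^2\<close> of the quadratic in \<open>t\<close> below; the added 1 avoids
      a zero denominator and keeps the value negative.\<close>
    define q where "q = (norm h)\<^sup>2 + 1"
    assume "f h \<noteq> inner h u"
    then have "d \<noteq> 0" by (simp add: d_def)
    have q: "q \<ge> 1" by (simp add: q_def)
    have expand: "J (u + t *\<^sub>R h) = J u + (2 * t * d + t\<^sup>2 * (norm h)\<^sup>2)" for t
      unfolding J_def d_def power2_norm_eq_inner power2_eq_square[of t]
      by (simp add: add scaleR inner_simps inner_commute[of u h] algebra_simps)
    have "0 \<le> 2 * (- d / q) * d + (- d / q)\<^sup>2 * (norm h)\<^sup>2"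
      using J_min[of "u + (- d / q) *\<^sub>R h"] unfolding expand by simp
    also have "\<dots> = - (d\<^sup>2 * (q + 1)) / q\<^sup>2"
    proof -
      have h: "(norm h)\<^sup>2 = q - 1" by (simp add: q_def)
      show ?thesis unfolding h using q by (simp add: field_simps power2_eq_square)
    qed
    also have "\<dots> < 0"
      using \<open>d \<noteq> 0\<close> q by simp
    finally show False by simp
  qed
  then show ?thesis by blast
qed

lemma cinner_scaleC_right: "cinner x (c *\<^sub>C y) = cnj c * cinner x y"
  by (metis cinner_commute cinner_scaleC_left complex_cnj_mult)

lemma cinner_scaleR_left: "cinner (r *\<^sub>R x) y = r *\<^sub>R cinner x y"
  unfolding scaleR_scaleC[of r x] cinner_scaleC_left by (simp add: scaleR_conv_of_real)

lemma cinner_scaleR_right: "cinner x (r *\<^sub>R y) = r *\<^sub>R cinner x y"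
  unfolding scaleR_scaleC[of r y] cinner_scaleC_right by (simp add: scaleR_conv_of_real)

lemma norm_scaleC: "norm (c *\<^sub>C (x::'a::complex_inner)) = cmod c * norm x"
proof (rule power2_eq_imp_eq)
  have "cinner (c *\<^sub>C x) (c *\<^sub>C x) = complex_of_real ((cmod c)\<^sup>2) * cinner x x"
    by (simp add: cinner_scaleC_left cinner_scaleC_right complex_norm_square del: of_real_power)
  then show "(norm (c *\<^sub>C x))\<^sup>2 = (cmod c * norm x)\<^sup>2"
    by (simp add: power2_norm_eq_inner inner_cinner power_mult_distrib)
qed auto

text \<open>A unimodular factor on \<open>x\<close> turns the inner product into its modulus, so the
  real Cauchy-Schwarz inequality applies.\<close>

lemma cmod_cinner_le: "cmod (cinner x y) \<le> norm x * norm y"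
proof (cases "cinner x y = 0")
  case False
  define c where "c = cnj (sgn (cinner x y))"
  have "cinner (c *\<^sub>C x) y = cmod (cinner x y)"
    unfolding cinner_scaleC_left c_def sgn_eq
    using False by (simp add: complex_norm_square[symmetric] mult.commute power2_eq_square)
  then have "cmod (cinner x y) = inner (c *\<^sub>C x) y" by (simp add: inner_cinner)
  also have "\<dots> \<le> norm (c *\<^sub>C x) * norm y" by (rule norm_cauchy_schwarz)
  also have "norm (c *\<^sub>C x) = norm x"
    using False by (simp add: norm_scaleC c_def norm_sgn)
  finally show ?thesis .
qed simp

text \<open>Complex linearity of \<open>f\<close> yields the imaginary part: it is read off the
  hypothesis at \<open>\<i> *\<^sub>C x\<close>.\<close>

lemma cinner_eq_if_inner_eq:
  assumes "bounded_clinear f" and "\<And>x. inner (f x) y = inner x z"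
  shows "cinner (f x) y = cinner x z"
proof (rule complex_eqI)
  interpret bounded_clinear f by fact
  show "Re (cinner (f x) y) = Re (cinner x z)"
    using assms(2)[of x] by (simp add: inner_cinner)
  show "Im (cinner (f x) y) = Im (cinner x z)"
    using assms(2)[of "\<i> *\<^sub>C x"] by (simp add: inner_cinner scaleC cinner_scaleC_left)
qed

text \<open>\<open>cadjoint\<close> is a definite description, so existence (Riesz, for each
  \<open>y\<close>) and uniqueness (testing against all \<open>x\<close>) are both shown.\<close>

lemma cinner_cadjoint:
  assumes f: "bounded_clinear f"
  shows "cinner (f x) y = cinner x (cadjoint f y)"
proof -
  interpret bounded_clinear f by fact
  have "\<exists>z. \<forall>x. inner (f x) y = inner x z" for y
    by (rule riesz_representation)
      (rule bounded_linear_compose[OF bounded_linear_inner_left bounded_linear_axioms])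
  then obtain g where g: "\<And>x y. inner (f x) y = inner x (g y)" by metis
  have "\<forall>x y. cinner (f x) y = cinner x (cadjoint f y)"
    unfolding cadjoint_def
  proof (rule theI[of "\<lambda>g. \<forall>x y. cinner (f x) y = cinner x (g y)" g])
    show "\<forall>x y. cinner (f x) y = cinner x (g y)"
      using cinner_eq_if_inner_eq[OF f] g by blast
    fix h assume h: "\<forall>x y. cinner (f x) y = cinner x (h y)"
    show "h = g"
    proof
      fix y
      have "\<forall>x. inner x (h y) = inner x (g y)"
        using h g by (metis inner_cinner)
      then show "h y = g y" using vector_eq_ldot by blast
    qed
  qed
  then show ?thesis by blast
qed

lemma inner_cadjoint: "bounded_clinear f \<Longrightarrow> inner (f x) y = inner x (cadjoint f y)"
  by (simp add: inner_cinner cinner_cadjoint)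

text \<open>For \<open>v = cadjoint f x\<close>, \<open>(norm v)^2 = inner (f v) x\<close> is at
  most \<open>onorm f * norm v * norm x\<close>; a factor \<open>norm v\<close> cancels.\<close>

lemma bounded_linear_cadjoint:
  assumes f: "bounded_clinear f"
  shows "bounded_linear (cadjoint f)"
proof (rule bounded_linear_intro)
  interpret bounded_clinear f by fact
  note adj = inner_cadjoint[OF f, symmetric]
  show "cadjoint f (x + y) = cadjoint f x + cadjoint f y" for x y
    by (rule vector_eq_ldot[THEN iffD1]) (simp add: adj inner_add_right)
  show "cadjoint f (r *\<^sub>R x) = r *\<^sub>R cadjoint f x" for r x
    by (rule vector_eq_ldot[THEN iffD1]) (simp add: adj)
  show "norm (cadjoint f x) \<le> norm x * onorm f" for x
  proof (cases "cadjoint f x = 0")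
    case True
    then show ?thesis by (simp add: onorm_pos_le[OF bounded_linear_axioms])
  next
    case False
    have "(norm (cadjoint f x))\<^sup>2 = inner (f (cadjoint f x)) x"
      by (simp add: power2_norm_eq_inner adj)
    also have "\<dots> \<le> norm (f (cadjoint f x)) * norm x" by (rule norm_cauchy_schwarz)
    also have "\<dots> \<le> (onorm f * norm (cadjoint f x)) * norm x"
      by (intro mult_right_mono onorm bounded_linear_axioms) simp
    finally show ?thesis
      using False by (simp add: power2_eq_square mult_ac)
  qed
qed

section \<open>The Davis-Wielandt radius\<close>

text \<open>At unit vectors these are the points of the Davis-Wielandt shell; as vectors they are
  open to the triangle inequality.\<close>

definition dw_point :: "('a::complex_inner \<Rightarrow> 'a) \<Rightarrow> 'a \<Rightarrow> complex \<times> real" where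
  "dw_point T z = (cinner (T z) z, (norm (T z))\<^sup>2)"

lemma dw_eq_SUP_norm_dw_point: "dw T = (SUP z\<in>{z. norm z = 1}. norm (dw_point T z))"
  by (simp add: dw_def dw_point_def norm_Pair)

text \<open>Homogeneity of degree 2 under real scaling reduces the claim to unit vectors. At
  \<open>x = 0\<close> both sides vanish, whatever \<open>dw T\<close> is.\<close>

lemma norm_dw_point_le_dw:
  assumes T: "bounded_clinear T"
  shows "norm (dw_point T x) \<le> (norm x)\<^sup>2 * dw T"
proof (cases "x = 0")
  case True
  interpret bounded_clinear T by fact
  from True show ?thesis
    using cmod_cinner_le[of "0::'a" "0::'a"] by (simp add: dw_point_def zero zero_prod_def[symmetric])
next
  case False
  interpret bounded_clinear T by fact
  have bl: "bounded_linear T" by unfold_locales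
  define z where "z = x /\<^sub>R norm x"
  \<comment> \<open>The supremum is an upper bound only once the set is known to be bounded
    above.\<close>
  have "norm (dw_point T w) \<le> onorm T + (onorm T)\<^sup>2" if "norm w = 1" for w
  proof -
    have w: "norm (T w) \<le> onorm T" using onorm[OF bl, of w] that by simp
    then have "cmod (cinner (T w) w) \<le> onorm T"
      using cmod_cinner_le[of "T w" w] that by simp
    moreover have "(norm (T w))\<^sup>2 \<le> (onorm T)\<^sup>2" using w by (simp add: power_mono)
    ultimately show ?thesis
      unfolding dw_point_def using norm_Pair_le[of "cinner (T w) w" "(norm (T w))\<^sup>2"] by simp
  qed
  then have "bdd_above ((\<lambda>z. norm (dw_point T z)) ` {z. norm z = 1})"
    by (auto intro!: bdd_aboveI2)
  moreover have "norm z = 1" using False by (simp add: z_def)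
  ultimately have "norm (dw_point T z) \<le> dw T"
    unfolding dw_eq_SUP_norm_dw_point by (intro cSUP_upper) auto
  moreover have "dw_point T x = (norm x)\<^sup>2 *\<^sub>R dw_point T z"
  proof -
    have x: "x = norm x *\<^sub>R z" using False by (simp add: z_def)
    show ?thesis
      unfolding dw_point_def
      by (subst (1 2 3) x)
        (simp add: scaleR cinner_scaleR_left cinner_scaleR_right power_mult_distrib power2_eq_square)
  qed
  ultimately show ?thesis by (simp add: mult_left_mono)
qed

text \<open>Two types are needed because the block matrix on \<open>'a \<times> 'a\<close> is
  compared with \<open>A\<close> on \<open>'a\<close>. Both suprema are over the empty set.\<close>

lemma dw_trivial_space:
  fixes S :: "'a::chilbert_space \<Rightarrow> 'a" and T :: "'b::chilbert_space \<Rightarrow> 'b"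
  assumes "\<And>x::'a. x = 0" and "\<And>x::'b. x = 0"
  shows "dw S = dw T"
proof -
  have "{z::'a. norm z = 1} = {}" "{z::'b. norm z = 1} = {}"
    using assms by (metis (mono_tags) empty_Collect_eq norm_zero zero_neq_one)+
  then show ?thesis by (simp only: dw_def image_empty)
qed

section \<open>The bound for upper triangular operator matrices\<close>

text \<open>The cross term \<open>2 * inner (A x) (B y)\<close> of the expanded square passes
  through the adjoint; this is the source of \<open>cadjoint A \<circ> B\<close> in the
  bound.\<close>

lemma dw_point_op_matrix_upper:
  assumes A: "bounded_clinear A"
  shows "dw_point (op_matrix A B (\<lambda>_. 0) C) (x, y) =
    dw_point A x + dw_point C y + (0, 2 * inner x (cadjoint A (B y)))
      + (cinner (B y) x, (norm (B y))\<^sup>2)"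
proof -
  have "(norm (A x + B y, C y))\<^sup>2
      = (norm (A x))\<^sup>2 + (norm (C y))\<^sup>2 + 2 * inner (A x) (B y) + (norm (B y))\<^sup>2"
    by (simp add: power2_norm_eq_inner inner_prod_def inner_simps inner_commute)
  then show ?thesis
    by (simp add: dw_point_def op_matrix_def cinner_prod_def cinner_add_left inner_cadjoint[OF A])
qed

text \<open>For \<open>b < 1 / sqrt 2\<close> the quadratic in \<open>u\<close> peaks at
  \<open>1 / (2 * (1 - b^2))\<close>, inside the unit interval; otherwise it increases there and
  \<open>u = 1\<close> is the maximiser.\<close>

lemma sqrt_quadratic_le:
  fixes b u :: real
  assumes b: "0 \<le> b" and u: "0 \<le> u" "u \<le> 1"
  shows "sqrt (b\<^sup>2 * (u - (1 - b\<^sup>2) * u\<^sup>2))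
    \<le> (if b < 1 / sqrt 2 then b / (2 * sqrt (1 - b\<^sup>2)) else b\<^sup>2)"
proof (cases "b < 1 / sqrt 2")
  case True
  have "b\<^sup>2 < (1 / sqrt 2)\<^sup>2" using True b by (intro power_strict_mono) auto
  then have pos: "0 < 1 - b\<^sup>2" by (simp add: power_divide)
  have "0 \<le> (2 * (1 - b\<^sup>2) * u - 1)\<^sup>2" by simp
  then have "(u - (1 - b\<^sup>2) * u\<^sup>2) * (4 * (1 - b\<^sup>2)) \<le> 1"
    by (simp add: power2_eq_square algebra_simps)
  then have "u - (1 - b\<^sup>2) * u\<^sup>2 \<le> 1 / (4 * (1 - b\<^sup>2))"
    using pos by (subst pos_le_divide_eq) auto
  then have "b\<^sup>2 * (u - (1 - b\<^sup>2) * u\<^sup>2) \<le> b\<^sup>2 * (1 / (4 * (1 - b\<^sup>2)))"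
    by (intro mult_left_mono) auto
  also have "\<dots> = (b / (2 * sqrt (1 - b\<^sup>2)))\<^sup>2"
    using pos by (simp add: power_divide power_mult_distrib)
  finally have "sqrt (b\<^sup>2 * (u - (1 - b\<^sup>2) * u\<^sup>2)) \<le> b / (2 * sqrt (1 - b\<^sup>2))"
    using b pos by (intro real_le_lsqrt) auto
  then show ?thesis using True by simp
next
  case False
  then have "(1 / sqrt 2)\<^sup>2 \<le> b\<^sup>2" by (intro power_mono) auto
  then have b2: "1 \<le> 2 * b\<^sup>2" by (simp add: power_divide)
  have "u - (1 - b\<^sup>2) * u\<^sup>2 \<le> b\<^sup>2"
  proof -
    \<comment> \<open>The gap \<open>b^2 - u + (1 - b^2) * u^2\<close> vanishes at
      \<open>u = 1\<close>, hence this factorization.\<close>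
    have "0 \<le> (1 - u) * (b\<^sup>2 * (1 + u) - u)"
    proof (intro mult_nonneg_nonneg)
      have "u \<le> (1 + u) / 2" using u by simp
      also have "\<dots> \<le> b\<^sup>2 * (1 + u)"
        using mult_right_mono[OF b2, of "1 + u"] u by simp
      finally show "0 \<le> b\<^sup>2 * (1 + u) - u" by simp
    qed (use u in simp)
    then show ?thesis by (simp add: power2_eq_square algebra_simps)
  qed
  then have "b\<^sup>2 * (u - (1 - b\<^sup>2) * u\<^sup>2) \<le> (b\<^sup>2)\<^sup>2"
    unfolding power2_eq_square[of "b\<^sup>2"] by (rule mult_left_mono) simp
  then have "sqrt (b\<^sup>2 * (u - (1 - b\<^sup>2) * u\<^sup>2)) \<le> b\<^sup>2"
    by (intro real_le_lsqrt) auto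
  then show ?thesis using False by simp
qed

lemma norm_off_diagonal_point_le:
  assumes B: "bounded_linear B" and xy: "(norm x)\<^sup>2 + (norm y)\<^sup>2 = 1"
  shows "norm (cinner (B y) x, (norm (B y))\<^sup>2)
    \<le> (if onorm B < 1 / sqrt 2 then onorm B / (2 * sqrt (1 - (onorm B)\<^sup>2)) else (onorm B)\<^sup>2)"
proof -
  define b u where "b = onorm B" and "u = (norm y)\<^sup>2"
  have b: "0 \<le> b" unfolding b_def by (rule onorm_pos_le[OF B])
  have u: "0 \<le> u" "u \<le> 1"
    using xy zero_le_power2[of "norm x"] unfolding u_def by (simp, linarith)
  have By: "norm (B y) \<le> b * norm y" unfolding b_def by (rule onorm[OF B])
  have "cmod (cinner (B y) x) \<le> b * norm y * norm x"
    using cmod_cinner_le[of "B y" x] mult_right_mono[OF By norm_ge_zero[of x]] by linarith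
  then have "(cmod (cinner (B y) x))\<^sup>2 \<le> (b * norm y * norm x)\<^sup>2" by (intro power_mono) auto
  moreover have "((norm (B y))\<^sup>2)\<^sup>2 \<le> ((b * norm y)\<^sup>2)\<^sup>2" using By by (intro power_mono) auto
  ultimately have "norm (cinner (B y) x, (norm (B y))\<^sup>2)
      \<le> sqrt ((b * norm y * norm x)\<^sup>2 + ((b * norm y)\<^sup>2)\<^sup>2)"
    unfolding norm_Pair real_norm_def power2_abs by (intro real_sqrt_le_mono add_mono)
  also have "(b * norm y * norm x)\<^sup>2 + ((b * norm y)\<^sup>2)\<^sup>2 = b\<^sup>2 * (u - (1 - b\<^sup>2) * u\<^sup>2)"
  proof -
    have x: "(norm x)\<^sup>2 = 1 - u" using xy by (simp add: u_def)
    show ?thesis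
      unfolding power_mult_distrib u_def[symmetric] x
      by (simp add: power2_eq_square algebra_simps)
  qed
  also have "sqrt \<dots> \<le> (if b < 1 / sqrt 2 then b / (2 * sqrt (1 - b\<^sup>2)) else b\<^sup>2)"
    by (rule sqrt_quadratic_le[OF b u])
  finally show ?thesis by (simp only: b_def)
qed

lemma two_inner_le_onorm:
  assumes S: "bounded_linear S" and xy: "(norm x)\<^sup>2 + (norm y)\<^sup>2 = 1"
  shows "\<bar>2 * inner x (S y)\<bar> \<le> onorm S"
proof -
  have "\<bar>inner x (S y)\<bar> \<le> norm x * norm (S y)" by (rule Cauchy_Schwarz_ineq2)
  also have "\<dots> \<le> norm x * (onorm S * norm y)"
    by (intro mult_left_mono onorm[OF S]) simp
  finally have "\<bar>2 * inner x (S y)\<bar> \<le> onorm S * (2 * norm x * norm y)"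
    by (simp add: abs_mult mult_ac)
  also have "\<dots> \<le> onorm S * 1"
    using sum_squares_bound[of "norm x" "norm y"] xy
    by (intro mult_left_mono onorm_pos_le[OF S]) simp
  finally show ?thesis by simp
qed

theorem theorem3p21:
  fixes A B C :: "'a::chilbert_space \<Rightarrow> 'a"
  assumes "bounded_clinear A" and "bounded_clinear B" and "bounded_clinear C"
  shows "dw (op_matrix A B (\<lambda>_. 0) C)
    \<le> max (dw A) (dw C) + onorm (cadjoint A \<circ> B)
      + (if onorm B < 1 / sqrt 2 then onorm B / (2 * sqrt (1 - (onorm B)\<^sup>2)) else (onorm B)\<^sup>2)"
    (is "dw ?T \<le> max _ _ + onorm ?S + ?r")
proof -
  have B: "bounded_linear B" using assms(2) by (simp add: bounded_clinear_def)
  have S: "bounded_linear ?S"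
    unfolding comp_def by (rule bounded_linear_compose[OF bounded_linear_cadjoint[OF assms(1)] B])
  show ?thesis
  \<comment> \<open>The zero space has no unit vectors, so \<open>cSUP_least\<close> does not apply
    to it.\<close>
  proof (cases "\<forall>x::'a. x = 0")
    case True
    have "dw ?T = dw A" by (rule dw_trivial_space) (use True in \<open>auto simp: prod_eq_iff\<close>)
    moreover have "0 \<le> onorm ?S" by (rule onorm_pos_le[OF S])
    \<comment> \<open>At \<open>u = 0\<close> the square root in \<open>sqrt_quadratic_le\<close> is
      0.\<close>
    moreover have "0 \<le> ?r"
      using norm_ge_zero sqrt_quadratic_le[OF onorm_pos_le[OF B], of 0] by simp
    ultimately show ?thesis by linarith
  next
    case False
    then obtain w :: 'a where "w \<noteq> 0" by blast
    then have "norm (w /\<^sub>R norm w, 0 :: 'a) = 1" by (simp add: norm_Pair)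
    then have nonempty: "{z::'a \<times> 'a. norm z = 1} \<noteq> {}" by blast
    show ?thesis
      unfolding dw_eq_SUP_norm_dw_point[of ?T]
    proof (rule cSUP_least[OF nonempty])
      fix z :: "'a \<times> 'a" assume z: "z \<in> {z. norm z = 1}"
      obtain x y where z_eq: "z = (x, y)" by fastforce
      have xy: "(norm x)\<^sup>2 + (norm y)\<^sup>2 = 1" using z by (simp add: z_eq norm_Pair)
      have "norm (dw_point ?T z) \<le> norm (dw_point A x) + norm (dw_point C y)
          + \<bar>2 * inner x (?S y)\<bar> + norm (cinner (B y) x, (norm (B y))\<^sup>2)"
        unfolding z_eq dw_point_op_matrix_upper[OF assms(1)]
        by (intro norm_triangle_le add_right_mono add_mono norm_triangle_ineq)
          (simp only: norm_Pair norm_zero real_norm_def comp_def, simp)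
      moreover have "norm (dw_point A x) + norm (dw_point C y) \<le> max (dw A) (dw C)"
      proof -
        have "norm (dw_point A x) + norm (dw_point C y) \<le> (norm x)\<^sup>2 * dw A + (norm y)\<^sup>2 * dw C"
          by (intro add_mono norm_dw_point_le_dw assms)
        also have "\<dots> \<le> max (dw A) (dw C)"
          by (rule convex_bound_le) (use xy in auto)
        finally show ?thesis .
      qed
      moreover have "\<bar>2 * inner x (?S y)\<bar> \<le> onorm ?S" by (rule two_inner_le_onorm[OF S xy])
      moreover have "norm (cinner (B y) x, (norm (B y))\<^sup>2) \<le> ?r"
        by (rule norm_off_diagonal_point_le[OF B xy])
      ultimately show "norm (dw_point ?T z) \<le> max (dw A) (dw C) + onorm ?S + ?r"
        by linarith
    qed
  qed
qed

end
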